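(* There is no separable group with bi-invariant metric that contains isometric copies of all separable groups with bi-invariant metric; that is, there is no group $G$ with a separable bi-invariant metric $d_G$ such that every group $H$ with a separable bi-invariant metric $d_H$ admits an isometric group monomorphism $(H,d_H)\to(G,d_G)$. Moreover, there is no metrically universal locally compact separable group with bi-invariant metric; that is, there is no locally compact separable group $(G,d_G)$ with bi-invariant metric such that every locally compact separable group $(H,d_H)$ with bi-invariant metric admits an isometric group monomorphism $(H,d_H)\to(G,d_G)$.
   Context: A metric $d$ on a group $G$ is bi-invariant if $d(xay,xby)=d(a,b)$ for all $x,y,a,b\in G$. A group with bi-invariant metric is a topological group in the topology induced by the metric; separability and local compactness refer to this topology. No bound on the diameter of the metrics is assumed. *)

theory Defs
  imports "HOL-Analysis.Analysis" "HOL-Algebra.Group"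
begin

(* Metric_space demands nonnegativity and symmetry of d on the whole type, not only on the
   carrier. This is no restriction, since values of d off the carrier play no role. *)
locale bi_invariant_metric_group =
  group G + Metric_space "carrier G" d for G (structure) and d +
  assumes bi_invariant:
    "\<lbrakk>x \<in> carrier G; y \<in> carrier G; a \<in> carrier G; b \<in> carrier G\<rbrakk>
      \<Longrightarrow> d (x \<otimes> a \<otimes> y) (x \<otimes> b \<otimes> y) = d a b"

definition isometric_mon ::
  "('a, 'm) monoid_scheme \<Rightarrow> ('a \<Rightarrow> 'a \<Rightarrow> real) \<Rightarrow>
   ('b, 'n) monoid_scheme \<Rightarrow> ('b \<Rightarrow> 'b \<Rightarrow> real) \<Rightarrow> ('a \<Rightarrow> 'b) set"
  where "isometric_mon H dH G dG =
    {h \<in> mon H G. \<forall>x\<in>carrier H. \<forall>y\<in>carrier H. dG (h x) (h y) = dH x y}"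

(* HOL cannot quantify over types inside a formula. A separable metric space has at most
   continuum many points, so groups H whose carrier is a set of reals represent all separable
   groups with bi-invariant metric. The results below establish this: an embedding property
   tested on such H holds for H over any type. *)

lemma separable_metric_inj_real:
  fixes d :: "'a \<Rightarrow> 'a \<Rightarrow> real"
  assumes "Metric_space M d" and "separable_space (Metric_space.mtopology M d)"
  shows "\<exists>g :: 'a \<Rightarrow> real. inj_on g M"
proof -
  interpret Metric_space M d by fact
  obtain D where D: "countable D" "D \<subseteq> M" "mtopology closure_of D = M"
    using assms(2) unfolding separable_space_def by auto
  define A :: "('a \<times> rat) set" where "A = D \<times> UNIV"
  have cA: "countable A" unfolding A_def using D by auto
  define F where "F x = {p \<in> A. d x (fst p) < of_rat (snd p)}" for x
  have injF: "inj_on F M"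
  proof (rule inj_onI, rule ccontr)
    fix x y assume x: "x \<in> M" and y: "y \<in> M" and e: "F x = F y" and n: "x \<noteq> y"
    have pos: "d x y / 2 > 0" using x y n by simp
    have "x \<in> mtopology closure_of D" using D x by simp
    then have "\<forall>r>0. \<exists>u\<in>D. u \<in> mball x r"
      unfolding metric_closure_of by blast
    then obtain u where u: "u \<in> D" "d x u < d x y / 2"
      using pos unfolding in_mball by blast
    obtain q where q: "d x u < of_rat q" "of_rat q < d x y / 2"
      using of_rat_dense[OF u(2)] by blast
    have "(u, q) \<in> F x" using u q by (simp add: F_def A_def)
    then have "(u, q) \<in> F y" using e by simp
    then have "d y u < of_rat q" by (simp add: F_def)
    moreover have "d x y \<le> d x u + d y u" using triangle' x y u D by blast
    ultimately show False using q by linarith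
  qed
  have "inj_on (\<lambda>S. to_nat_on A ` S) (Pow A)"
    using inj_on_image_Pow inj_on_to_nat_on[OF cA] by blast
  moreover have "F ` M \<subseteq> Pow A" by (auto simp: F_def)
  ultimately have inj2: "inj_on ((\<lambda>S. to_nat_on A ` S) \<circ> F) M"
    by (intro comp_inj_on[OF injF]) (rule inj_on_subset)
  obtain r :: "nat set \<Rightarrow> real" where r: "inj r"
    using nat_sets_eqpoll_reals unfolding eqpoll_def bij_betw_def by blast
  have "inj_on (r \<circ> ((\<lambda>S. to_nat_on A ` S) \<circ> F)) M"
    using comp_inj_on[OF inj2 inj_on_subset[OF r subset_UNIV]] by blast
  then show ?thesis by blast
qed

lemma separable_bi_invariant_real_copy:
  fixes G :: "('a, 'm) monoid_scheme" and d :: "'a \<Rightarrow> 'a \<Rightarrow> real"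
  assumes "bi_invariant_metric_group G d"
    and "separable_space (Metric_space.mtopology (carrier G) d)"
  obtains H :: "real monoid" and dH and h
  where "bi_invariant_metric_group H dH" "h \<in> iso G H" "h \<in> isometric_mon G d H dH"
    "Metric_space.mtopology (carrier G) d homeomorphic_space
      Metric_space.mtopology (carrier H) dH"
proof -
  interpret G: bi_invariant_metric_group G d by fact
  obtain g :: "'a \<Rightarrow> real" where g: "inj_on g (carrier G)"
    using separable_metric_inj_real[OF G.Metric_space_axioms assms(2)] by blast
  define k where "k = inv_into (carrier G) g"
  have kg[simp]: "k (g x) = x" if "x \<in> carrier G" for x
    using g that by (simp add: k_def)
  define H :: "real monoid" where
    "H = \<lparr>carrier = g ` carrier G, mult = \<lambda>a b. g (k a \<otimes>\<^bsub>G\<^esub> k b), one = g \<one>\<^bsub>G\<^esub>\<rparr>"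
  define dH where "dH a b = d (k a) (k b)" for a b
  have cH[simp]: "carrier H = g ` carrier G" by (simp add: H_def)
  have mH[simp]: "a \<otimes>\<^bsub>H\<^esub> b = g (k a \<otimes>\<^bsub>G\<^esub> k b)" for a b by (simp add: H_def)
  have oH[simp]: "\<one>\<^bsub>H\<^esub> = g \<one>\<^bsub>G\<^esub>" by (simp add: H_def)
  interpret H: group H
  proof (rule groupI)
    fix x assume "x \<in> carrier H"
    then obtain a where "a \<in> carrier G" "x = g a" by auto
    then show "\<exists>y\<in>carrier H. y \<otimes>\<^bsub>H\<^esub> x = \<one>\<^bsub>H\<^esub>"
      by (auto intro!: bexI[of _ "inv\<^bsub>G\<^esub> a"])
  qed (auto simp: G.m_assoc)
  interpret H: Metric_space "carrier H" dH
    by (rule Metric_space.intro)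
      (auto simp: dH_def G.commute inj_on_eq_iff[OF g] intro: G.triangle)
  have bi: "bi_invariant_metric_group H dH"
    by unfold_locales (auto simp: dH_def G.bi_invariant)
  have iso: "g \<in> iso G H"
    using g by (simp add: iso_def hom_def bij_betw_def)
  have im: "g \<in> isometric_mon G d H dH"
    using iso by (auto simp: isometric_mon_def iso_iff_mon_epi dH_def)
  interpret M: Metric_space12 "carrier G" d "carrier H" dH
    by (simp add: Metric_space12_def G.Metric_space_axioms H.Metric_space_axioms del: cH)
  have "homeomorphic_map G.mtopology H.mtopology g"
    by (rule M.isometry_imp_homeomorphic_map) (auto simp: dH_def)
  then have "G.mtopology homeomorphic_space H.mtopology"
    using homeomorphic_map_imp_homeomorphic_space by blast
  then show thesis using that bi iso im by blast
qed

lemma isometric_mon_compose: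
  assumes "h \<in> isometric_mon H dH K dK" and "k \<in> isometric_mon K dK G dG"
  shows "k \<circ> h \<in> isometric_mon H dH G dG"
  using assms mon_compose[of h H K k G]
  by (auto simp: isometric_mon_def mon_def hom_def Pi_iff)

lemma separable_universal_any_type:
  fixes H :: "('b, 'n) monoid_scheme" and G :: "('a, 'm) monoid_scheme"
  assumes "\<And>(K :: real monoid) dK.
      bi_invariant_metric_group K dK \<Longrightarrow>
      separable_space (Metric_space.mtopology (carrier K) dK) \<Longrightarrow>
      isometric_mon K dK G dG \<noteq> {}"
    and "bi_invariant_metric_group H dH"
    and "separable_space (Metric_space.mtopology (carrier H) dH)"
  shows "isometric_mon H dH G dG \<noteq> {}"
proof -
  obtain K :: "real monoid" and dK h
    where K: "bi_invariant_metric_group K dK" "h \<in> isometric_mon H dH K dK"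
      "Metric_space.mtopology (carrier H) dH homeomorphic_space
        Metric_space.mtopology (carrier K) dK"
    by (rule separable_bi_invariant_real_copy[OF assms(2,3)])
  have "isometric_mon K dK G dG \<noteq> {}"
    using assms(1)[OF K(1)] homeomorphic_separable_space[OF K(3)] assms(3) by blast
  then show ?thesis using isometric_mon_compose[OF K(2)] by blast
qed

lemma locally_compact_separable_universal_any_type:
  fixes H :: "('b, 'n) monoid_scheme" and G :: "('a, 'm) monoid_scheme"
  assumes "\<And>(K :: real monoid) dK.
      bi_invariant_metric_group K dK \<Longrightarrow>
      separable_space (Metric_space.mtopology (carrier K) dK) \<Longrightarrow>
      locally_compact_space (Metric_space.mtopology (carrier K) dK) \<Longrightarrow>
      isometric_mon K dK G dG \<noteq> {}"
    and "bi_invariant_metric_group H dH"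
    and "separable_space (Metric_space.mtopology (carrier H) dH)"
    and "locally_compact_space (Metric_space.mtopology (carrier H) dH)"
  shows "isometric_mon H dH G dG \<noteq> {}"
proof -
  obtain K :: "real monoid" and dK h
    where K: "bi_invariant_metric_group K dK" "h \<in> isometric_mon H dH K dK"
      "Metric_space.mtopology (carrier H) dH homeomorphic_space
        Metric_space.mtopology (carrier K) dK"
    by (rule separable_bi_invariant_real_copy[OF assms(2,3)])
  have "isometric_mon K dK G dG \<noteq> {}"
    using assms(1)[OF K(1)] homeomorphic_separable_space[OF K(3)]
      homeomorphic_locally_compact_space[OF K(3)] assms(3,4) by blast
  then show ?thesis using isometric_mon_compose[OF K(2)] by blast
qed

end

theory Submission
  imports Defs "HOL-Algebra.Generated_Groups"
begin

text \<open>
  In a group with bi-invariant metric, a word of length \<open>l\<close> in \<open>x\<close>, \<open>y\<close> moves by at most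
  \<open>l * \<epsilon>\<close> when \<open>x\<close> and \<open>y\<close> move by at most \<open>\<epsilon>\<close>. In the unit quaternions let \<open>a\<^sub>k\<close>, \<open>b\<^sub>k\<close> be the
  rotations by the angle \<open>pi / (2 * 8 ^ k)\<close> about two orthogonal axes, and multiply the distance
  by \<open>8 ^ k\<close>. The powers with exponent \<open>n = 8 ^ i\<close> fail to commute by the amount
  \<open>2 * 8 ^ k * sin\<^sup>2 (n * pi / (2 * 8 ^ k))\<close>, which is \<open>2 * n\<close> for \<open>k = i\<close> and at most \<open>n\<close> for every
  other \<open>k\<close>: for \<open>k < i\<close> because quaternion distances are bounded, for \<open>k > i\<close> because the sine is
  small and occurs squared. Each set \<open>S\<close> of indices gives a metric, the supremum over \<open>k \<in> S\<close>, on
  the group generated by \<open>a = (a\<^sub>k)\<close> and \<open>b = (b\<^sub>k)\<close>; truncated below at 1 it is discrete. If all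
  these metric groups embedded in one separable group, then for two different \<open>S\<close> the images of
  \<open>a\<close>, \<open>b\<close> would be closer than \<open>1/4\<close>, and the commutation defects of the \<open>n\<close>-th powers could not
  differ by \<open>n\<close>.
\<close>

section \<open>Words in generators and countability\<close>

text \<open>Serves to bound cardinality: there are only countably many finite words over a countable
  alphabet, and evaluation turns concatenation into multiplication.\<close>

lemma generate_subset_words:
  assumes "group G" and "A \<subseteq> carrier G"
  shows "generate G A \<subseteq> (\<lambda>xs. foldr (mult G) xs \<one>\<^bsub>G\<^esub>) ` lists (A \<union> m_inv G ` A)"
proof
  interpret group G by fact
  let ?e = "\<lambda>xs. foldr (mult G) xs \<one>\<^bsub>G\<^esub>" and ?L = "lists (A \<union> m_inv G ` A)"
  have closed: "?e xs \<in> carrier G" if "xs \<in> ?L" for xs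
    using that assms(2) by (induction xs) auto
  have app: "?e (xs @ ys) = ?e xs \<otimes>\<^bsub>G\<^esub> ?e ys" if "xs \<in> ?L" "ys \<in> ?L" for xs ys
    using that(1)
  proof (induction xs)
    case Nil
    then show ?case using closed[OF that(2)] by simp
  next
    case (Cons x xs)
    then have "x \<in> carrier G" using assms(2) by auto
    then show ?case using Cons closed[OF that(2)] closed[of xs] by (simp add: m_assoc)
  qed
  fix x assume "x \<in> generate G A"
  then show "x \<in> ?e ` ?L"
  proof induction
    case one
    show ?case by (rule image_eqI[of _ _ "[]"]) auto
  next
    case (incl h)
    then show ?case using assms(2) by (intro image_eqI[of _ _ "[h]"]) auto
  next
    case (inv h)
    then show ?case using assms(2) by (intro image_eqI[of _ _ "[inv\<^bsub>G\<^esub> h]"]) auto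
  next
    case (eng g h)
    then obtain xs ys where "xs \<in> ?L" "g = ?e xs" "ys \<in> ?L" "h = ?e ys" by blast
    then show ?case using app by (intro image_eqI[of _ _ "xs @ ys"]) auto
  qed
qed

lemma countable_generate:
  assumes "group G" and "A \<subseteq> carrier G" and "countable A"
  shows "countable (generate G A)"
  by (rule countable_subset[OF generate_subset_words[OF assms(1,2)]]) (simp add: assms(3))

section \<open>Stability of words under a bi-invariant metric\<close>

context bi_invariant_metric_group
begin

text \<open>Translations on either side are isometries, so the factors can be exchanged one at a
  time, passing through \<open>a' \<otimes> b\<close>.\<close>

lemma mult_dist_le:
  assumes "a \<in> carrier G" "b \<in> carrier G" "a' \<in> carrier G" "b' \<in> carrier G"
  shows "d (a \<otimes> b) (a' \<otimes> b') \<le> d a a' + d b b'"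
proof -
  have "d (a \<otimes> b) (a' \<otimes> b') \<le> d (a \<otimes> b) (a' \<otimes> b) + d (a' \<otimes> b) (a' \<otimes> b')"
    using assms by (intro triangle) auto
  moreover have "d (a \<otimes> b) (a' \<otimes> b) = d a a'"
    using bi_invariant[of \<one> b a a'] assms by simp
  moreover have "d (a' \<otimes> b) (a' \<otimes> b') = d b b'"
    using bi_invariant[of a' \<one> b b'] assms by simp
  ultimately show ?thesis by simp
qed

lemma pow_dist_le:
  assumes "a \<in> carrier G" "a' \<in> carrier G"
  shows "d (a [^] n) (a' [^] (n::nat)) \<le> real n * d a a'"
proof (induction n)
  case 0
  then show ?case by simp
next
  case (Suc n)
  have "d (a [^] Suc n) (a' [^] Suc n) \<le> d (a [^] n) (a' [^] n) + d a a'"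
    using mult_dist_le[of "a [^] n" a "a' [^] n" a'] assms by simp
  with Suc show ?case by (simp add: algebra_simps)
qed

lemma pow_mult_pow_dist_le:
  assumes "a \<in> carrier G" "b \<in> carrier G" "a' \<in> carrier G" "b' \<in> carrier G"
    and "d a a' \<le> e" "d b b' \<le> e"
  shows "d (a [^] n \<otimes> b [^] n) (a' [^] n \<otimes> b' [^] (n::nat)) \<le> 2 * real n * e"
proof -
  have "d (a [^] n \<otimes> b [^] n) (a' [^] n \<otimes> b' [^] n)
      \<le> d (a [^] n) (a' [^] n) + d (b [^] n) (b' [^] n)"
    using assms by (intro mult_dist_le) auto
  also have "\<dots> \<le> real n * d a a' + real n * d b b'"
    using assms by (intro add_mono pow_dist_le) auto
  also have "\<dots> \<le> real n * e + real n * e"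
    using assms by (intro add_mono mult_left_mono) auto
  finally show ?thesis by (simp add: algebra_simps)
qed

text \<open>Each of the two products is a word of length \<open>2 * n\<close>, so each moves by at
  most \<open>2 * n * e\<close>; the triangle inequality adds both errors.\<close>

lemma commutation_defect_le:
  assumes "a \<in> carrier G" "b \<in> carrier G" "a' \<in> carrier G" "b' \<in> carrier G"
    and "d a a' \<le> e" "d b b' \<le> e"
  shows "d (a [^] n \<otimes> b [^] n) (b [^] n \<otimes> a [^] n)
    \<le> d (a' [^] n \<otimes> b' [^] n) (b' [^] n \<otimes> a' [^] (n::nat)) + 4 * real n * e"
proof -
  let ?ab = "a [^] n \<otimes> b [^] n" and ?ba = "b [^] n \<otimes> a [^] n"
    and ?ab' = "a' [^] n \<otimes> b' [^] n" and ?ba' = "b' [^] n \<otimes> a' [^] n"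
  have "d ?ab ?ab' \<le> 2 * real n * e" "d ?ba ?ba' \<le> 2 * real n * e"
    using assms by (auto intro: pow_mult_pow_dist_le)
  moreover have "d ?ab ?ba \<le> d ?ab ?ab' + d ?ab' ?ba" "d ?ab' ?ba \<le> d ?ab' ?ba' + d ?ba' ?ba"
    using assms by (auto intro: triangle)
  ultimately show ?thesis using commute[of ?ba ?ba'] by linarith
qed

end

section \<open>Quaternions and two one-parameter groups of rotations\<close>

text \<open>The pair \<open>(z, w)\<close> encodes the quaternion \<open>z + w * j\<close>, where \<open>j * z = cnj z * j\<close>.\<close>

type_synonym quat = "complex \<times> complex"

definition qmul :: "quat \<Rightarrow> quat \<Rightarrow> quat" where
  "qmul x y = (fst x * fst y - snd x * cnj (snd y), fst x * snd y + snd x * cnj (fst y))"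

definition qone :: quat where
  "qone = (1, 0)"

definition qcnj :: "quat \<Rightarrow> quat" where
  "qcnj x = (cnj (fst x), - snd x)"

lemma qmul_assoc: "qmul (qmul x y) z = qmul x (qmul y z)"
  by (simp add: qmul_def algebra_simps)

lemma qmul_one [simp]: "qmul qone x = x" "qmul x qone = x"
  by (simp_all add: qmul_def qone_def)

lemma qmul_diff_left: "qmul (x - y) z = qmul x z - qmul y z"
  by (simp add: qmul_def algebra_simps)

lemma qmul_diff_right: "qmul z (x - y) = qmul z x - qmul z y"
  by (simp add: qmul_def algebra_simps)

lemma norm_quat_power2: "(norm (x :: quat))\<^sup>2 = (cmod (fst x))\<^sup>2 + (cmod (snd x))\<^sup>2"
  by (simp add: norm_prod_def)

text \<open>Squared and written in real and imaginary parts, this is Euler's four-square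
  identity.\<close>

lemma norm_qmul [simp]: "norm (qmul x y) = norm x * norm y"
proof -
  have "(norm (qmul x y))\<^sup>2 = (norm x * norm y)\<^sup>2"
    unfolding power_mult_distrib norm_quat_power2 qmul_def cmod_power2
    by (simp add: algebra_simps power2_eq_square)
  then show ?thesis by (simp add: power2_eq_iff_nonneg)
qed

lemma norm_qone [simp]: "norm qone = 1"
  by (simp add: qone_def norm_prod_def)

lemma norm_qcnj [simp]: "norm (qcnj x) = norm x"
  by (simp add: qcnj_def norm_prod_def)

lemma norm_qcnj_diff_one: "norm (qcnj x - qone) = norm (x - qone)"
proof -
  have "qcnj x - qone = qcnj (x - qone)" by (simp add: qcnj_def qone_def)
  then show ?thesis by simp
qed

lemma qmul_qcnj_left:
  assumes "norm x = 1"
  shows "qmul (qcnj x) x = qone"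
proof -
  have "(cmod (fst x))\<^sup>2 + (cmod (snd x))\<^sup>2 = 1"
    using assms norm_quat_power2[of x] by simp
  then have "fst x * cnj (fst x) + snd x * cnj (snd x) = 1"
    unfolding complex_norm_square[symmetric] by (metis of_real_1 of_real_add)
  then show ?thesis by (simp add: qmul_def qcnj_def qone_def algebra_simps)
qed

text \<open>The one-parameter group \<open>exp (t * i)\<close>.\<close>

definition rot_i :: "real \<Rightarrow> quat" where
  "rot_i t = (cis t, 0)"

text \<open>The one-parameter group \<open>exp (t * j)\<close>.\<close>

definition rot_j :: "real \<Rightarrow> quat" where
  "rot_j t = (of_real (cos t), of_real (sin t))"

lemma rot_0 [simp]: "rot_i 0 = qone" "rot_j 0 = qone"
  by (simp_all add: rot_i_def rot_j_def qone_def)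

lemma qmul_rot_i: "qmul (rot_i s) (rot_i t) = rot_i (s + t)"
  by (simp add: qmul_def rot_i_def cis_mult)

lemma qmul_rot_j: "qmul (rot_j s) (rot_j t) = rot_j (s + t)"
  by (simp add: qmul_def rot_j_def cos_add sin_add)

lemma norm_rot [simp]: "norm (rot_i t) = 1" "norm (rot_j t) = 1"
  by (simp_all add: rot_i_def rot_j_def norm_prod_def)

text \<open>A chord is no longer than its arc: the chord has length
  \<open>2 * \<bar>sin (t / 2)\<bar>\<close>.\<close>

lemma norm_cis_diff_one: "cmod (cis t - 1) \<le> \<bar>t\<bar>"
proof -
  have "(cmod (cis t - 1))\<^sup>2 = 2 - 2 * cos t"
    unfolding cmod_power2 using sin_cos_squared_add[of t]
    by (simp add: power2_eq_square algebra_simps)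
  also have "\<dots> = 4 * (sin (t / 2))\<^sup>2"
    using cos_double_sin[of "t / 2"] by simp
  also have "\<dots> \<le> 4 * (t / 2)\<^sup>2"
    using abs_sin_x_le_abs_x[of "t / 2"] by (simp only: abs_le_square_iff)
  also have "\<dots> = t\<^sup>2" by (simp add: power2_eq_square)
  finally show ?thesis by (metis abs_le_square_iff abs_norm_cancel)
qed

lemma norm_rot_diff_one: "norm (rot_i t - qone) \<le> \<bar>t\<bar>" "norm (rot_j t - qone) \<le> \<bar>t\<bar>"
proof -
  show "norm (rot_i t - qone) \<le> \<bar>t\<bar>"
    using norm_cis_diff_one[of t] by (simp add: rot_i_def qone_def norm_prod_def)
  \<comment> \<open>Both sides are the distance from (cos t, sin t) to (1, 0) in the plane.\<close>
  have "norm (rot_j t - qone) = cmod (cis t - 1)"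
    unfolding norm_prod_def rot_j_def qone_def
    by (simp add: cmod_def power2_commute)
  then show "norm (rot_j t - qone) \<le> \<bar>t\<bar>" using norm_cis_diff_one[of t] by simp
qed

text \<open>In (cos t + i sin t)(cos t + j sin t) only the term with both sines depends on the
  order, and i, j anticommute. The defect is therefore quadratic in small t.\<close>

lemma rot_commutation_defect:
  "norm (qmul (rot_i t) (rot_j t) - qmul (rot_j t) (rot_i t)) = 2 * (sin t)\<^sup>2"
proof -
  have "qmul (rot_i t) (rot_j t) - qmul (rot_j t) (rot_i t)
      = (0, of_real (2 * (sin t)\<^sup>2) * \<i>)"
    by (simp add: qmul_def rot_i_def rot_j_def complex_eq_iff power2_eq_square)
  then show ?thesis by (simp only: norm_Pair1 norm_mult norm_of_real) simp
qed

section \<open>Sequences of unit quaternions with weighted supremum metrics\<close>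

text \<open>The boundedness condition makes the weighted suprema finite for all index sets
  \<open>S\<close> at once, so that one carrier serves all the metrics.\<close>

definition seq_group :: "(nat \<Rightarrow> quat) monoid" where
  "seq_group = \<lparr>carrier = {x. (\<forall>k. norm (x k) = 1) \<and> bdd_above (range (\<lambda>k. 8 ^ k * norm (x k - qone)))},
     mult = \<lambda>x y k. qmul (x k) (y k), one = \<lambda>k. qone\<rparr>"

lemma carrier_seq_groupI:
  assumes "\<And>k. norm (x k) = 1" and "\<And>k. 8 ^ k * norm (x k - qone) \<le> C"
  shows "x \<in> carrier seq_group"
  using assms(1) bdd_aboveI2[of UNIV, OF assms(2)] by (simp add: seq_group_def)

lemma carrier_seq_groupE:
  assumes "x \<in> carrier seq_group"
  obtains C where "\<And>k. norm (x k) = 1" and "\<And>k. 8 ^ k * norm (x k - qone) \<le> C"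
  using assms by (auto simp: seq_group_def bdd_above_def)

lemma seq_group_simps [simp]:
  "x \<otimes>\<^bsub>seq_group\<^esub> y = (\<lambda>k. qmul (x k) (y k))" "\<one>\<^bsub>seq_group\<^esub> = (\<lambda>k. qone)"
  by (simp_all add: seq_group_def)

lemma group_seq_group: "group seq_group"
proof (rule groupI)
  fix x y assume "x \<in> carrier seq_group" "y \<in> carrier seq_group"
  then obtain C D where x: "\<And>k. norm (x k) = 1" "\<And>k. 8 ^ k * norm (x k - qone) \<le> C"
    and y: "\<And>k. norm (y k) = 1" "\<And>k. 8 ^ k * norm (y k - qone) \<le> D"
    by (auto elim!: carrier_seq_groupE)
  have "8 ^ k * norm (qmul (x k) (y k) - qone) \<le> C + D" for k
  proof -
    \<comment> \<open>Multiplication by the unit quaternion \<open>x k\<close> preserves the norm,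
      so the distances to \<open>qone\<close> add up and the bounds \<open>C\<close>,
      \<open>D\<close> give \<open>C + D\<close>.\<close>
    have eq: "qmul (x k) (y k) - qone = qmul (x k) (y k - qone) + (x k - qone)"
      by (simp add: qmul_diff_right)
    have "norm (qmul (x k) (y k) - qone) \<le> norm (qmul (x k) (y k - qone)) + norm (x k - qone)"
      unfolding eq by (rule norm_triangle_ineq)
    then have "norm (qmul (x k) (y k) - qone) \<le> norm (x k - qone) + norm (y k - qone)"
      by (simp add: x(1))
    then have "8 ^ k * norm (qmul (x k) (y k) - qone)
        \<le> 8 ^ k * (norm (x k - qone) + norm (y k - qone))"
      by (intro mult_left_mono) auto
    then show ?thesis using x(2)[of k] y(2)[of k] by (simp add: distrib_left)
  qed
  then show "x \<otimes>\<^bsub>seq_group\<^esub> y \<in> carrier seq_group"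
    using x y by (intro carrier_seq_groupI) auto
next
  fix x assume "x \<in> carrier seq_group"
  then obtain C where x: "\<And>k. norm (x k) = 1" "\<And>k. 8 ^ k * norm (x k - qone) \<le> C"
    by (auto elim!: carrier_seq_groupE)
  then show "\<exists>y\<in>carrier seq_group. y \<otimes>\<^bsub>seq_group\<^esub> x = \<one>\<^bsub>seq_group\<^esub>"
    by (intro bexI[of _ "\<lambda>k. qcnj (x k)"] carrier_seq_groupI)
      (auto simp: qmul_qcnj_left norm_qcnj_diff_one)
next
  show "\<one>\<^bsub>seq_group\<^esub> \<in> carrier seq_group"
    by (rule carrier_seq_groupI[of _ 0]) auto
qed (auto simp: qmul_assoc)

definition weight_dist :: "nat set \<Rightarrow> (nat \<Rightarrow> quat) \<Rightarrow> (nat \<Rightarrow> quat) \<Rightarrow> nat \<Rightarrow> real" where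
  "weight_dist S x y k = (if k \<in> S then 8 ^ k * norm (x k - y k) else 0)"

text \<open>For sequences outside \<open>seq_group\<close> the supremum may be a junk value; the maximum with 1 keeps
  the distance nonnegative there, as \<open>Metric_space\<close> demands on the whole type.\<close>

definition seq_dist :: "nat set \<Rightarrow> (nat \<Rightarrow> quat) \<Rightarrow> (nat \<Rightarrow> quat) \<Rightarrow> real" where
  "seq_dist S x y = (if x = y then 0 else max 1 (SUP k. weight_dist S x y k))"

lemma weight_dist_commute: "weight_dist S x y = weight_dist S y x"
  by (auto simp: weight_dist_def norm_minus_commute)

lemma weight_dist_triangle: "weight_dist S x z k \<le> weight_dist S x y k + weight_dist S y z k"
proof -
  have "norm (x k - z k) \<le> norm (x k - y k) + norm (y k - z k)"
    using norm_triangle_ineq[of "x k - y k" "y k - z k"] by simp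
  then have "8 ^ k * norm (x k - z k) \<le> 8 ^ k * (norm (x k - y k) + norm (y k - z k))"
    by (intro mult_left_mono) auto
  then show ?thesis by (simp add: weight_dist_def distrib_left)
qed

lemma bdd_weight_dist:
  assumes "x \<in> carrier seq_group" "y \<in> carrier seq_group"
  shows "bdd_above (range (weight_dist S x y))"
proof -
  obtain C D where C: "\<And>k. 8 ^ k * norm (x k - qone) \<le> C" and D: "\<And>k. 8 ^ k * norm (y k - qone) \<le> D"
    using assms by (auto elim!: carrier_seq_groupE)
  have "weight_dist S x y k \<le> C + D" for k
  proof -
    have "weight_dist S x y k
        \<le> weight_dist S x (\<lambda>_. qone) k + weight_dist S y (\<lambda>_. qone) k"
      using weight_dist_triangle weight_dist_commute by metis
    also have "\<dots> \<le> 8 ^ k * norm (x k - qone) + 8 ^ k * norm (y k - qone)"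
      by (intro add_mono) (auto simp: weight_dist_def)
    finally show ?thesis using C[of k] D[of k] by linarith
  qed
  then show ?thesis by (rule bdd_aboveI2)
qed

lemma weight_dist_le_seq_dist:
  assumes "x \<in> carrier seq_group" "y \<in> carrier seq_group"
  shows "weight_dist S x y k \<le> seq_dist S x y"
proof (cases "x = y")
  case True
  then show ?thesis by (simp add: weight_dist_def seq_dist_def)
next
  case False
  have "weight_dist S x y k \<le> (SUP k. weight_dist S x y k)"
    by (intro cSUP_upper bdd_weight_dist assms) simp
  with False show ?thesis by (simp add: seq_dist_def)
qed

text \<open>The condition \<open>1 \<le> C\<close> accounts for the truncation at 1.\<close>

lemma seq_dist_le:
  assumes "\<And>k. weight_dist S x y k \<le> C" and "1 \<le> C"
  shows "seq_dist S x y \<le> C"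
  using assms cSUP_least[of UNIV "weight_dist S x y" C] by (simp add: seq_dist_def)

lemma one_le_seq_dist: "x \<noteq> y \<Longrightarrow> 1 \<le> seq_dist S x y"
  by (simp add: seq_dist_def)

lemma bi_invariant_seq_group: "bi_invariant_metric_group seq_group (seq_dist S)"
proof -
  interpret group seq_group by (rule group_seq_group)
  interpret Metric_space "carrier seq_group" "seq_dist S"
  proof
    fix x y
    show "0 \<le> seq_dist S x y" by (simp add: seq_dist_def le_max_iff_disj)
    show "seq_dist S x y = seq_dist S y x"
      by (simp add: seq_dist_def weight_dist_commute)
  next
    fix x y
    show "seq_dist S x y = 0 \<longleftrightarrow> x = y"
      by (auto simp: seq_dist_def max_def)
  next
    fix x y z
    assume xyz: "x \<in> carrier seq_group" "y \<in> carrier seq_group" "z \<in> carrier seq_group"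
    show "seq_dist S x z \<le> seq_dist S x y + seq_dist S y z"
    \<comment> \<open>If neither equality holds, both summands on the right are at least 1, so
      truncating the left side at 1 does no harm.\<close>
    proof (cases "x = y \<or> y = z")
      case True
      then show ?thesis by (auto simp: seq_dist_def)
    next
      case False
      have "weight_dist S x z k \<le> seq_dist S x y + seq_dist S y z" for k
        using weight_dist_triangle[of S x z k y] weight_dist_le_seq_dist xyz add_mono
        by (meson order_trans)
      moreover have "1 \<le> seq_dist S x y + seq_dist S y z"
        using False one_le_seq_dist[of x y S] one_le_seq_dist[of y z S] by simp
      ultimately show ?thesis by (rule seq_dist_le)
    qed
  qed
  show ?thesis
  proof unfold_locales
    fix x y a b
    assume x: "x \<in> carrier seq_group" and y: "y \<in> carrier seq_group"
      and ab: "a \<in> carrier seq_group" "b \<in> carrier seq_group"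
    let ?a = "x \<otimes>\<^bsub>seq_group\<^esub> a \<otimes>\<^bsub>seq_group\<^esub> y" and ?b = "x \<otimes>\<^bsub>seq_group\<^esub> b \<otimes>\<^bsub>seq_group\<^esub> y"
    \<comment> \<open>Multiplying by unit quaternions on both sides preserves the norm in every
      coordinate.\<close>
    have "norm (?a k - ?b k) = norm (a k - b k)" for k
    proof -
      have "?a k - ?b k = qmul (qmul (x k) (a k - b k)) (y k)"
        by (simp add: qmul_diff_left qmul_diff_right)
      then show ?thesis using x y by (auto elim!: carrier_seq_groupE)
    qed
    then have "weight_dist S ?a ?b = weight_dist S a b"
      by (simp add: weight_dist_def fun_eq_iff)
    moreover have "?a = ?b \<longleftrightarrow> a = b" using x y ab by (simp del: seq_group_simps)
    ultimately show "seq_dist S ?a ?b = seq_dist S a b"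
      by (simp add: seq_dist_def del: seq_group_simps)
  qed
qed

section \<open>The two-generator group and its family of discrete metrics\<close>

text \<open>The power \<open>8 ^ k\<close> has angle \<open>pi / 2\<close> in coordinate
  \<open>k\<close>, where the sine is 1; the weighted distances to \<open>qone\<close> stay below
  \<open>pi / 2\<close>.\<close>

definition gen_a :: "nat \<Rightarrow> quat" where
  "gen_a k = rot_i (pi / 2 / 8 ^ k)"

definition gen_b :: "nat \<Rightarrow> quat" where
  "gen_b k = rot_j (pi / 2 / 8 ^ k)"

text \<open>One group for all \<open>S\<close>; only the metric varies. Finite generation makes it
  countable, hence separable although discrete.\<close>

definition two_gen_group :: "(nat \<Rightarrow> quat) monoid" where
  "two_gen_group = seq_group\<lparr>carrier := generate seq_group {gen_a, gen_b}\<rparr>"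

lemma gen_in_seq_group: "{gen_a, gen_b} \<subseteq> carrier seq_group"
proof -
  have "8 ^ k * norm (gen_a k - qone) \<le> pi / 2" for k
    using norm_rot_diff_one(1)[of "pi / 2 / 8 ^ k"] by (simp add: gen_a_def field_simps)
  moreover have "8 ^ k * norm (gen_b k - qone) \<le> pi / 2" for k
    using norm_rot_diff_one(2)[of "pi / 2 / 8 ^ k"] by (simp add: gen_b_def field_simps)
  ultimately show ?thesis
    by (auto intro!: carrier_seq_groupI[of _ "pi / 2"] simp: gen_a_def gen_b_def)
qed

lemma carrier_two_gen_group_subset: "carrier two_gen_group \<subseteq> carrier seq_group"
  using group.generate_incl[OF group_seq_group gen_in_seq_group]
  by (simp add: two_gen_group_def)

lemma two_gen_group_simps [simp]:
  "mult two_gen_group = mult seq_group" "one two_gen_group = one seq_group"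
  by (simp_all add: two_gen_group_def)

lemma gen_in_two_gen_group: "gen_a \<in> carrier two_gen_group" "gen_b \<in> carrier two_gen_group"
  by (auto simp: two_gen_group_def intro: generate.incl)

lemma group_two_gen_group: "group two_gen_group"
  unfolding two_gen_group_def
  by (intro group.subgroup_imp_group group.generate_is_subgroup group_seq_group gen_in_seq_group)

lemma bi_invariant_two_gen_group: "bi_invariant_metric_group two_gen_group (seq_dist S)"
proof -
  interpret G: bi_invariant_metric_group seq_group "seq_dist S" by (rule bi_invariant_seq_group)
  interpret H: group two_gen_group by (rule group_two_gen_group)
  interpret H: Metric_space "carrier two_gen_group" "seq_dist S"
    by (rule G.subspace[OF carrier_two_gen_group_subset])
  show ?thesis
    using G.bi_invariant carrier_two_gen_group_subset
    by unfold_locales (auto simp: subset_iff simp del: seq_group_simps)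
qed

text \<open>Distinct points are at distance at least 1, so open balls of radius 1 are
  singletons.\<close>

lemma mtopology_two_gen_group:
  "Metric_space.mtopology (carrier two_gen_group) (seq_dist S) = discrete_topology (carrier two_gen_group)"
proof -
  interpret bi_invariant_metric_group two_gen_group "seq_dist S"
    by (rule bi_invariant_two_gen_group)
  have "openin mtopology {x}" if "x \<in> carrier two_gen_group" for x
  proof -
    have "mball x 1 = {x}"
      using that one_le_seq_dist[of x _ S] by (force simp: mball_def seq_dist_def)
    then show ?thesis by (metis openin_mball)
  qed
  then have "discrete_topology (carrier two_gen_group) = mtopology"
    by (simp add: discrete_topology_unique)
  then show ?thesis ..
qed

lemma separable_two_gen_group:
  "separable_space (Metric_space.mtopology (carrier two_gen_group) (seq_dist S))"
  using countable_generate[OF group_seq_group gen_in_seq_group]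
  unfolding mtopology_two_gen_group separable_space_discrete_topology
  by (simp add: two_gen_group_def)

lemma locally_compact_two_gen_group:
  "locally_compact_space (Metric_space.mtopology (carrier two_gen_group) (seq_dist S))"
  unfolding mtopology_two_gen_group by (rule locally_compact_space_discrete_topology)

lemma gen_pow:
  "gen_a [^]\<^bsub>two_gen_group\<^esub> (n::nat) = (\<lambda>k. rot_i (real n * (pi / 2 / 8 ^ k)))"
  "gen_b [^]\<^bsub>two_gen_group\<^esub> n = (\<lambda>k. rot_j (real n * (pi / 2 / 8 ^ k)))"
proof -
  interpret group two_gen_group by (rule group_two_gen_group)
  show "gen_a [^]\<^bsub>two_gen_group\<^esub> n = (\<lambda>k. rot_i (real n * (pi / 2 / 8 ^ k)))"
    by (induction n) (auto simp: gen_a_def qmul_rot_i ring_distribs add_divide_distrib add.commute)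
  show "gen_b [^]\<^bsub>two_gen_group\<^esub> n = (\<lambda>k. rot_j (real n * (pi / 2 / 8 ^ k)))"
    by (induction n) (auto simp: gen_b_def qmul_rot_j ring_distribs add_divide_distrib add.commute)
qed

section \<open>Commutation defects of the powers\<close>

definition pow_ab :: "nat \<Rightarrow> nat \<Rightarrow> quat" where
  "pow_ab n = gen_a [^]\<^bsub>two_gen_group\<^esub> n \<otimes>\<^bsub>two_gen_group\<^esub> gen_b [^]\<^bsub>two_gen_group\<^esub> n"

definition pow_ba :: "nat \<Rightarrow> nat \<Rightarrow> quat" where
  "pow_ba n = gen_b [^]\<^bsub>two_gen_group\<^esub> n \<otimes>\<^bsub>two_gen_group\<^esub> gen_a [^]\<^bsub>two_gen_group\<^esub> n"

lemma pow_in_two_gen_group: "pow_ab n \<in> carrier two_gen_group" "pow_ba n \<in> carrier two_gen_group"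
proof -
  interpret group two_gen_group by (rule group_two_gen_group)
  show "pow_ab n \<in> carrier two_gen_group" "pow_ba n \<in> carrier two_gen_group"
    unfolding pow_ab_def pow_ba_def using gen_in_two_gen_group
    by (simp_all del: two_gen_group_simps)
qed

lemma weight_dist_pow:
  "weight_dist S (pow_ab n) (pow_ba n) k
    = (if k \<in> S then 2 * 8 ^ k * (sin (real n * (pi / 2 / 8 ^ k)))\<^sup>2 else 0)"
  by (simp add: weight_dist_def pow_ab_def pow_ba_def gen_pow rot_commutation_defect)

lemma seq_dist_pow_ge:
  assumes "i \<in> S"
  shows "2 * 8 ^ i \<le> seq_dist S (pow_ab (8 ^ i)) (pow_ba (8 ^ i))"
proof -
  have "weight_dist S (pow_ab (8 ^ i)) (pow_ba (8 ^ i)) i = 2 * 8 ^ i"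
    using assms by (simp add: weight_dist_pow)
  then show ?thesis
    using weight_dist_le_seq_dist[of "pow_ab (8 ^ i)" "pow_ba (8 ^ i)" S i]
      pow_in_two_gen_group carrier_two_gen_group_subset by auto
qed

lemma seq_dist_pow_le:
  assumes "i \<notin> S"
  shows "seq_dist S (pow_ab (8 ^ i)) (pow_ba (8 ^ i)) \<le> 8 ^ i"
proof (rule seq_dist_le)
  fix k
  define t :: real where "t = real (8 ^ i) * (pi / 2 / 8 ^ k)"
  have "2 * 8 ^ k * (sin t)\<^sup>2 \<le> 8 ^ i" if "k \<noteq> i"
  proof (cases "k < i")
    case True
    \<comment> \<open>Early coordinates: the sine is bounded by 1 and the weight is smaller than
      \<open>8 ^ i\<close> by a factor of at least 8, which absorbs the 2.\<close>
    then have "(8::real) ^ Suc k \<le> 8 ^ i" by (intro power_increasing) auto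
    then have "2 * 8 ^ k \<le> (8::real) ^ i"
      using zero_le_power[of "8::real" k] unfolding power_Suc by linarith
    moreover have "(sin t)\<^sup>2 \<le> 1" by (simp add: abs_square_le_1)
    ultimately show ?thesis
      using mult_mono[of "2 * 8 ^ k" "8 ^ i" "(sin t)\<^sup>2" 1] by simp
  next
    case False
    \<comment> \<open>Late coordinates: the weight exceeds \<open>8 ^ i\<close> by the factor
      \<open>8 ^ Suc m\<close>, but the squared sine is at most \<open>4 / 64 ^ Suc m\<close>. The
      bound \<open>pi < 4\<close> supplies the numerator 2 before squaring.\<close>
    with that have "i < k" by simp
    then obtain m where m: "k = Suc (i + m)" using less_imp_Suc_add by blast
    have t: "t = pi / 2 / 8 ^ Suc m" by (simp add: t_def m power_add)
    have "\<bar>sin t\<bar> \<le> \<bar>t\<bar>" by (rule abs_sin_x_le_abs_x)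
    also have "\<dots> \<le> 2 / 8 ^ Suc m"
      unfolding t using pi_less_4 by (simp add: field_simps)
    finally have "(sin t)\<^sup>2 \<le> (2 / 8 ^ Suc m)\<^sup>2"
      by (metis abs_ge_zero power2_abs power_mono)
    then have "2 * 8 ^ k * (sin t)\<^sup>2 \<le> 2 * 8 ^ k * (2 / 8 ^ Suc m)\<^sup>2"
      by (intro mult_left_mono) auto
    also have "\<dots> = 8 ^ i / 8 ^ m"
      by (simp add: m power_add field_simps power2_eq_square)
    also have "\<dots> \<le> 8 ^ i" by (simp add: divide_le_eq)
    finally show ?thesis .
  qed
  then show "weight_dist S (pow_ab (8 ^ i)) (pow_ba (8 ^ i)) k \<le> 8 ^ i"
    using assms unfolding weight_dist_pow t_def[symmetric] by auto
qed simp

section \<open>Separation of embeddings and the counting argument\<close>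

lemma image_pow_isometric_mon:
  assumes "group G" and "h \<in> isometric_mon two_gen_group (seq_dist S) G dG"
  shows "dG (h gen_a [^]\<^bsub>G\<^esub> n \<otimes>\<^bsub>G\<^esub> h gen_b [^]\<^bsub>G\<^esub> n) (h gen_b [^]\<^bsub>G\<^esub> n \<otimes>\<^bsub>G\<^esub> h gen_a [^]\<^bsub>G\<^esub> n)
    = seq_dist S (pow_ab n) (pow_ba n)"
proof -
  interpret H: group two_gen_group by (rule group_two_gen_group)
  interpret G: group G by fact
  have h: "h \<in> hom two_gen_group G"
    and iso: "\<And>x y. x \<in> carrier two_gen_group \<Longrightarrow> y \<in> carrier two_gen_group
      \<Longrightarrow> dG (h x) (h y) = seq_dist S x y"
    using assms(2) by (auto simp: isometric_mon_def mon_def)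
  interpret group_hom two_gen_group G h
    using h by (simp add: group_hom_def group_hom_axioms_def H.group_axioms G.group_axioms)
  have "h (pow_ab n) = h gen_a [^]\<^bsub>G\<^esub> n \<otimes>\<^bsub>G\<^esub> h gen_b [^]\<^bsub>G\<^esub> n"
    "h (pow_ba n) = h gen_b [^]\<^bsub>G\<^esub> n \<otimes>\<^bsub>G\<^esub> h gen_a [^]\<^bsub>G\<^esub> n"
    unfolding pow_ab_def pow_ba_def using gen_in_two_gen_group
    by (simp_all add: hom_nat_pow del: two_gen_group_simps)
  then show ?thesis using iso pow_in_two_gen_group by metis
qed

text \<open>At exponent \<open>8 ^ i\<close> the defect is at least \<open>2 * 8 ^ i\<close> for
  \<open>S\<close> and at most \<open>8 ^ i\<close> for \<open>S'\<close>, while generators within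
  \<open>e\<close> allow a difference of at most \<open>4 * 8 ^ i * e\<close>.\<close>

lemma isometric_mon_two_gen_separated:
  assumes "bi_invariant_metric_group G dG"
    and "h \<in> isometric_mon two_gen_group (seq_dist S) G dG"
    and "h' \<in> isometric_mon two_gen_group (seq_dist S') G dG"
    and "i \<in> S" "i \<notin> S'"
    and "dG (h gen_a) (h' gen_a) \<le> e" "dG (h gen_b) (h' gen_b) \<le> e"
  shows "1 / 4 \<le> e"
proof -
  interpret bi_invariant_metric_group G dG by fact
  have "h gen_a \<in> carrier G" "h gen_b \<in> carrier G" "h' gen_a \<in> carrier G" "h' gen_b \<in> carrier G"
    using assms(2,3) gen_in_two_gen_group by (auto simp: isometric_mon_def mon_def hom_def)
  from commutation_defect_le[OF this assms(6,7), of "8 ^ i"]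
  have "seq_dist S (pow_ab (8 ^ i)) (pow_ba (8 ^ i))
      \<le> seq_dist S' (pow_ab (8 ^ i)) (pow_ba (8 ^ i)) + 4 * 8 ^ i * e"
    using image_pow_isometric_mon[OF group_axioms assms(2)]
      image_pow_isometric_mon[OF group_axioms assms(3)] by simp
  then have "8 ^ i * 1 \<le> (8::real) ^ i * (4 * e)"
    using seq_dist_pow_ge[OF assms(4)] seq_dist_pow_le[OF assms(5)]
    unfolding mult.commute[of 4] mult.assoc by linarith
  then have "1 \<le> 4 * e" by (rule mult_left_le_imp_le) simp
  then show ?thesis by simp
qed

text \<open>There are uncountably many sets \<open>S\<close>, but rounding the images of the two
  generators to a countable dense set leaves only countably many pairs.\<close>

lemma no_separable_group_contains_all_two_gen_groups:
  assumes "bi_invariant_metric_group G dG"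
    and "separable_space (Metric_space.mtopology (carrier G) dG)"
  shows "\<exists>S. isometric_mon two_gen_group (seq_dist S) G dG = {}"
proof (rule ccontr)
  assume "\<not> ?thesis"
  then have "\<forall>S. \<exists>h. h \<in> isometric_mon two_gen_group (seq_dist S) G dG" by blast
  then obtain h where h: "\<And>S. h S \<in> isometric_mon two_gen_group (seq_dist S) G dG" by metis
  interpret bi_invariant_metric_group G dG by fact
  obtain D where D: "countable D" "D \<subseteq> carrier G" "mtopology closure_of D = carrier G"
    using assms(2) by (auto simp: separable_space_def)
  \<comment> \<open>Points with the same approximant within 1/16 are at distance at most 1/8, below
    the separation 1/4.\<close>
  have "\<exists>u\<in>D. dG x u < 1 / 16" if "x \<in> carrier G" for x
  proof -
    have "\<forall>r>0. \<exists>u\<in>D. u \<in> mball x r"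
      using that D(3) unfolding metric_closure_of by blast
    from this[rule_format, of "1 / 16"] show ?thesis by auto
  qed
  then obtain u where u: "\<And>x. x \<in> carrier G \<Longrightarrow> u x \<in> D \<and> dG x (u x) < 1 / 16" by metis
  have hG: "h S gen_a \<in> carrier G" "h S gen_b \<in> carrier G" for S
    using h[of S] gen_in_two_gen_group by (auto simp: isometric_mon_def mon_def hom_def)
  have near: "dG x y \<le> 1 / 8" if "x \<in> carrier G" "y \<in> carrier G" "u x = u y" for x y
  proof -
    have "dG x y \<le> dG x (u x) + dG y (u x)"
      using triangle'[of x "u x" y] u[OF that(1)] D(2) that by auto
    then show ?thesis using u[OF that(1)] u[OF that(2)] that(3) by simp
  qed
  define F where "F S = (u (h S gen_a), u (h S gen_b))" for S
  have "inj F"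
  proof (rule injI, rule ccontr)
    fix S S' assume F: "F S = F S'" and "S \<noteq> S'"
    then obtain i where "i \<in> S \<and> i \<notin> S' \<or> i \<in> S' \<and> i \<notin> S" by blast
    \<comment> \<open>Both orders are recorded because the separating index may lie in either of the
      two sets.\<close>
    moreover have "dG (h S gen_a) (h S' gen_a) \<le> 1 / 8" "dG (h S gen_b) (h S' gen_b) \<le> 1 / 8"
      "dG (h S' gen_a) (h S gen_a) \<le> 1 / 8" "dG (h S' gen_b) (h S gen_b) \<le> 1 / 8"
      using F hG by (auto simp only: F_def prod.inject intro!: near)
    ultimately have "(1::real) / 4 \<le> 1 / 8"
      using isometric_mon_two_gen_separated[OF assms(1) h h] by metis
    then show False by simp
  qed
  moreover have "countable (range F)"
    by (rule countable_subset[of _ "D \<times> D"]) (use u hG D(1) in \<open>auto simp: F_def\<close>)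
  ultimately have "countable (UNIV :: nat set set)"
    using countable_image_inj_on by blast
  then have "countable (UNIV :: real set)"
    using nat_sets_eqpoll_reals countable_eqpoll eqpoll_sym by blast
  then show False using uncountable_UNIV_real by blast
qed

theorem theorem0p4:
  shows "(\<nexists>(G :: 'a monoid) dG.
            bi_invariant_metric_group G dG \<and>
            separable_space (Metric_space.mtopology (carrier G) dG) \<and>
            (\<forall>(H :: real monoid) dH.
               bi_invariant_metric_group H dH \<and>
               separable_space (Metric_space.mtopology (carrier H) dH) \<longrightarrow>
               (\<exists>h. h \<in> isometric_mon H dH G dG))) \<and>
         (\<nexists>(G :: 'a monoid) dG.
            bi_invariant_metric_group G dG \<and>
            locally_compact_space (Metric_space.mtopology (carrier G) dG) \<and>
            separable_space (Metric_space.mtopology (carrier G) dG) \<and>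
            (\<forall>(H :: real monoid) dH.
               bi_invariant_metric_group H dH \<and>
               locally_compact_space (Metric_space.mtopology (carrier H) dH) \<and>
               separable_space (Metric_space.mtopology (carrier H) dH) \<longrightarrow>
               (\<exists>h. h \<in> isometric_mon H dH G dG)))"
proof -
  \<comment> \<open>The test groups are both separable and locally compact, so one contradiction
    refutes both kinds of universality. Their elements are sequences of quaternions; the transfer
    lemma passes from real carriers to this type.\<close>
  have False
    if "bi_invariant_metric_group G dG"
      and "separable_space (Metric_space.mtopology (carrier G) dG)"
      and univ: "\<And>(K :: real monoid) dK.
        bi_invariant_metric_group K dK \<Longrightarrow>
        separable_space (Metric_space.mtopology (carrier K) dK) \<Longrightarrow>
        locally_compact_space (Metric_space.mtopology (carrier K) dK) \<Longrightarrow>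
        isometric_mon K dK G dG \<noteq> {}"
    for G :: "'a monoid" and dG
    using no_separable_group_contains_all_two_gen_groups[OF that(1,2)]
      locally_compact_separable_universal_any_type[OF univ bi_invariant_two_gen_group
        separable_two_gen_group locally_compact_two_gen_group]
    by blast
  then show ?thesis by (intro conjI notI) (metis equals0D)+
qed

end
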